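(* The spherical functions $\Phi_{\xi_m}:\Lambda_M\to\mathbb{R}$, $m\in\Lambda_M$, are eigenfunctions of the Laplacian $L$ in $l^2(\Lambda_M,\Delta)$: $$L\Phi_{\xi_m}=2\cos(\xi_m)\,\Phi_{\xi_m}\qquad(m\in\Lambda_M).$$
   Context: Fix $\tau\in(0,1)$ and an integer $M>1$; $\Lambda_M:=\{0,1,\dots,M\}$. Affine Weyl group: $W=\langle s,u\mid s^2=u^2=1\rangle$, $s_1:=s$, $s_0:=usu$, $W_S:=\langle s_0,s_1\rangle$. Every $w\in W$ can be written uniquely as $w=u^{i_0}s_{i_1}\cdots s_{i_r}$ with $i_j\in\{0,1\}$ and $r\ge 0$ minimal (reduced expression); $\ell(w):=r$. $\mathcal{C}(\mathbb{Z})$ is the space of functions $f:\mathbb{Z}\to\mathbb{C}$, with $f_n:=f(n)$. $W$ acts on $\mathbb{Z}$ by $sn=-n$, $un=M-n$ and on $\mathcal{C}(\mathbb{Z})$ by $(wf)(n)=f(w^{-1}n)$. $\Lambda_M$ is a fundamental domain for $W_S$ on $\mathbb{Z}$; $w_n$ is the unique shortest element of $W_S$ with $w_nn\in\Lambda_M$, and $n_+:=w_nn$. Laplacian: $L:\mathcal{C}(\mathbb{Z})\to\mathcal{C}(\mathbb{Z})$ is the operator representing the central element $X+X^{-1}$ of the double affine Hecke algebra in its difference-reflection representation; explicitly $(Lf)_n=a_nf_{n+1}+b_nf_{n-1}$ with $a_n=\tau^2$ if $n\in M\mathbb{Z}_{>0}$ and $a_n=1$ otherwise, $b_n=\tau^2$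 if $n\in M\mathbb{Z}_{\le0}$ and $b_n=1$ otherwise. $L$ preserves the space $\mathcal{C}(\mathbb{Z})^{W_S}$ of $W_S$-invariant functions, which is identified with functions on $\Lambda_M$ by restriction; the induced action on $f:\Lambda_M\to\mathbb{C}$ is $(Lf)_0=(1+\tau^2)f_1$, $(Lf)_n=f_{n+1}+f_{n-1}$ for $0<n<M$, $(Lf)_M=(1+\tau^2)f_{M-1}$. $l^2(\Lambda_M,\Delta)$ is the space of functions $f:\Lambda_M\to\mathbb{C}$ with inner product $\langle f,g\rangle_\Delta=\sum_{n\in\Lambda_M}f_n\overline{g_n}\Delta_n$, where $\Delta_0=\Delta_M=(1+\tau^2)^{-1}$ and $\Delta_n=1$ for $0<n<M$. Spherical function: let $I:=\tau s+(\tau-\tau^{-1})J$, where $(Jf)_n:=-f_{n-2}-f_{n-4}-\dots-f_{-n}$ if $n>0$, $(Jf)_0:=0$, $(Jf)_n:=f_n+f_{n+2}+\dots+f_{-n-2}$ if $n<0$ (steps of $2$, $|n|$ terms). For a reduced expression $w=u^{i_0}s_{i_1}\cdots s_{i_r}$ put $I_w:=u^{i_0}I_{s_{i_1}}\cdots I_{s_{i_r}}$ with $I_{s_1}:=I$, $I_{s_0}:=uIu$, and let $(\mathcal{J}f)_n:=\tau^{-\ell(w_n)}(I_{w_n}f)_{n_+}$. For $\xi\in\mathbb{R}$, $\Phi_\xi:=\mathcal{J}\phi_\xi$ with $\phi_\xi:=(1+\tau I)\mathbf{e}^{i\xi}$, where $\mathbf{e}^{i\xi}(n):=e^{i\xi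 n}$. In particular $\Phi_\xi(n)=\phi_\xi(n)=c(\xi)e^{i\xi n}+c(-\xi)e^{-i\xi n}$ for $n\in\Lambda_M$, $\xi\notin\pi\mathbb{Z}$, with $c(\xi):=\frac{1-\tau^2e^{-2i\xi}}{1-e^{-2i\xi}}$. Spectral values: $V(\xi):=M\xi+\theta(\xi)$ with $\theta(\xi):=(1-\tau^4)\int_0^{2\xi}\frac{dx}{1+\tau^4-2\tau^2\cos x}$; for $m\in\Lambda_M$, $\xi_m$ is the unique real solution of $V(\xi)=(m+1)\pi$; it lies in $(0,\pi)$, and $\Phi_{\xi_m}$ is $W_S$-invariant and real-valued, so it is regarded as a function on $\Lambda_M$. *)

theory Defs
  imports "HOL-Analysis.Analysis" "HOL-Algebra.Generated_Groups"
begin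

subsection \<open>The affine Weyl group\<close>

datatype gen = GenS | GenU

inductive cancel :: "gen list \<Rightarrow> gen list \<Rightarrow> bool" where
  "cancel (xs @ [g, g] @ ys) (xs @ ys)"

text \<open>
  The abstract group presented by \<open>\<langle>s, u | s\<^sup>2 = u\<^sup>2 = 1\<rangle>\<close>, as words in the generators modulo the
  equivalence generated by cancellation. The monoid so presented is already a group, as the
  generators are involutions.
\<close>
quotient_type waff = "gen list" / "equivclp cancel"
  by (rule equivp_evquivclp)

lemma cancel_append: "cancel xs ys \<Longrightarrow> cancel (as @ xs @ bs) (as @ ys @ bs)"
  by (metis (no_types, opaque_lifting) append.assoc cancel.simps)

lemma equivclp_cancel_append:
  assumes "equivclp cancel xs ys"
  shows "equivclp cancel (as @ xs @ bs) (as @ ys @ bs)"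
  using assms
  by (induction rule: equivclp_induct)
    (auto intro: equivclp_into_equivclp cancel_append)

lift_definition waff_mult :: "waff \<Rightarrow> waff \<Rightarrow> waff" is "(@)"
  by (metis append.left_neutral append.right_neutral equivclp_cancel_append equivclp_trans)

lift_definition waff_one :: waff is "[]" .

definition W :: "waff monoid" where
  "W = \<lparr>carrier = UNIV, monoid.mult = waff_mult, one = waff_one\<rparr>"

lemma equivclp_cancel_rev: "equivclp cancel (rev xs @ xs) []"
proof (induction xs)
  case (Cons g xs)
  have "cancel (rev xs @ [g, g] @ xs) (rev xs @ xs)"
    by (rule cancel.intros)
  then have "equivclp cancel (rev (g # xs) @ g # xs) (rev xs @ xs)"
    by (simp add: r_into_equivclp)
  with Cons.IH show ?case
    by (blast intro: equivclp_trans)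
qed simp

lemma group_W: "group W"
proof (rule groupI)
  fix x y z
  show "x \<otimes>\<^bsub>W\<^esub> y \<otimes>\<^bsub>W\<^esub> z = x \<otimes>\<^bsub>W\<^esub> (y \<otimes>\<^bsub>W\<^esub> z)"
    unfolding W_def by simp (transfer, simp)
  show "\<one>\<^bsub>W\<^esub> \<otimes>\<^bsub>W\<^esub> x = x"
    unfolding W_def by simp (transfer, simp)
  show "\<exists>y\<in>carrier W. y \<otimes>\<^bsub>W\<^esub> x = \<one>\<^bsub>W\<^esub>"
    unfolding W_def by simp (transfer, blast intro: equivclp_cancel_rev)
qed (simp_all add: W_def)

lift_definition w_s :: waff is "[GenS]" .
lift_definition w_u :: waff is "[GenU]" .

definition w_refl :: "nat \<Rightarrow> waff" where
  "w_refl i = (if i = 0 then w_u \<otimes>\<^bsub>W\<^esub> w_s \<otimes>\<^bsub>W\<^esub> w_u else w_s)"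

definition W_S :: "waff set" where
  "W_S = generate W {w_refl 0, w_refl 1}"

text \<open>
  \<open>is_expr w i0 js\<close> says that \<open>w\<close> equals \<open>u\<close> to the power \<open>i0\<close> times the product of the
  \<open>s\<^sub>j\<close>, \<open>j\<close> running through the list \<open>js\<close>.
\<close>
definition is_expr :: "waff \<Rightarrow> nat \<Rightarrow> nat list \<Rightarrow> bool" where
  "is_expr w i0 js \<longleftrightarrow> i0 \<in> {0, 1} \<and> set js \<subseteq> {0, 1} \<and>
     w = (w_u [^]\<^bsub>W\<^esub> i0) \<otimes>\<^bsub>W\<^esub> foldr (\<lambda>j v. w_refl j \<otimes>\<^bsub>W\<^esub> v) js \<one>\<^bsub>W\<^esub>"

definition w_len :: "waff \<Rightarrow> nat" where
  "w_len w = (LEAST r. \<exists>i0 js. is_expr w i0 js \<and> length js = r)"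

definition is_reduced_expr :: "waff \<Rightarrow> nat \<Rightarrow> nat list \<Rightarrow> bool" where
  "is_reduced_expr w i0 js \<longleftrightarrow> is_expr w i0 js \<and> length js = w_len w"

subsection \<open>The actions on the integers and on functions\<close>

fun gen_act :: "int \<Rightarrow> gen \<Rightarrow> int \<Rightarrow> int" where
  "gen_act M GenS n = - n"
| "gen_act M GenU n = M - n"

lemma gen_act_gen_act [simp]: "gen_act M g (gen_act M g n) = n"
  by (cases g) auto

lift_definition w_act :: "int \<Rightarrow> waff \<Rightarrow> int \<Rightarrow> int" is "\<lambda>M xs n. foldr (gen_act M) xs n"
proof (rule ext)
  fix M n and xs ys :: "gen list"
  assume "equivclp cancel xs ys"
  then show "foldr (gen_act M) xs n = foldr (gen_act M) ys n"
    by (induction rule: equivclp_induct) (auto elim!: cancel.cases)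
qed

definition fun_act :: "int \<Rightarrow> waff \<Rightarrow> (int \<Rightarrow> complex) \<Rightarrow> (int \<Rightarrow> complex)" where
  "fun_act M w f = (\<lambda>n. f (w_act M (inv\<^bsub>W\<^esub> w) n))"

definition W_S_invariant :: "int \<Rightarrow> (int \<Rightarrow> complex) \<Rightarrow> bool" where
  "W_S_invariant M f \<longleftrightarrow> (\<forall>w\<in>W_S. fun_act M w f = f)"

definition \<Lambda> :: "int \<Rightarrow> int set" where
  "\<Lambda> M = {0..M}"

text \<open>The shortest element of \<open>W_S\<close> carrying \<open>n\<close> into \<open>\<Lambda> M\<close> is unique for positive \<open>M\<close>.\<close>
definition w_min :: "int \<Rightarrow> int \<Rightarrow> waff" where
  "w_min M n = arg_min w_len (\<lambda>w. w \<in> W_S \<and> w_act M w n \<in> \<Lambda> M)"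

definition n_plus :: "int \<Rightarrow> int \<Rightarrow> int" where
  "n_plus M n = w_act M (w_min M n) n"

subsection \<open>The Laplacian\<close>

text \<open>
  The operator representing \<open>X + X\<inverse>\<close> in the difference-reflection representation of the double
  affine Hecke algebra, in its explicit form.
\<close>
definition laplacian :: "real \<Rightarrow> int \<Rightarrow> (int \<Rightarrow> complex) \<Rightarrow> (int \<Rightarrow> complex)" where
  "laplacian \<tau> M f = (\<lambda>n.
     (if n \<in> {M * k | k. k > 0} then of_real (\<tau>\<^sup>2) else 1) * f (n + 1) +
     (if n \<in> {M * k | k. k \<le> 0} then of_real (\<tau>\<^sup>2) else 1) * f (n - 1))"

text \<open>Functions on \<open>\<Lambda> M\<close> are represented as functions on the integers that are \<open>undefined\<close>
  outside of \<open>\<Lambda> M\<close>.\<close>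
definition laplacian_\<Lambda> :: "real \<Rightarrow> int \<Rightarrow> (int \<Rightarrow> complex) \<Rightarrow> (int \<Rightarrow> complex)" where
  "laplacian_\<Lambda> \<tau> M f = (\<lambda>n\<in>\<Lambda> M.
     if n = 0 then of_real (1 + \<tau>\<^sup>2) * f 1
     else if n = M then of_real (1 + \<tau>\<^sup>2) * f (M - 1)
     else f (n + 1) + f (n - 1))"

definition \<Delta> :: "real \<Rightarrow> int \<Rightarrow> int \<Rightarrow> real" where
  "\<Delta> \<tau> M n = (if n = 0 \<or> n = M then inverse (1 + \<tau>\<^sup>2) else 1)"

definition l2 :: "real \<Rightarrow> int \<Rightarrow> (int \<Rightarrow> complex) set" where
  "l2 \<tau> M = {f \<in> extensional (\<Lambda> M). (\<lambda>n. (cmod (f n))\<^sup>2 * \<Delta> \<tau> M n) summable_on \<Lambda> M}"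

definition is_eigenfunction :: "real \<Rightarrow> int \<Rightarrow> (int \<Rightarrow> complex) \<Rightarrow> complex \<Rightarrow> bool" where
  "is_eigenfunction \<tau> M f c \<longleftrightarrow>
     f \<in> l2 \<tau> M \<and> (\<exists>n\<in>\<Lambda> M. f n \<noteq> 0) \<and> laplacian_\<Lambda> \<tau> M f = (\<lambda>n\<in>\<Lambda> M. c * f n)"

subsection \<open>The spherical function\<close>

definition J_op :: "(int \<Rightarrow> complex) \<Rightarrow> (int \<Rightarrow> complex)" where
  "J_op f = (\<lambda>n.
     if n > 0 then - (\<Sum>k\<in>{1..n}. f (n - 2 * k))
     else if n < 0 then (\<Sum>k\<in>{0..<- n}. f (n + 2 * k))
     else 0)"

definition I_op :: "real \<Rightarrow> int \<Rightarrow> (int \<Rightarrow> complex) \<Rightarrow> (int \<Rightarrow> complex)" where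
  "I_op \<tau> M f = (\<lambda>n. of_real \<tau> * fun_act M w_s f n + of_real (\<tau> - inverse \<tau>) * J_op f n)"

definition I_refl :: "real \<Rightarrow> int \<Rightarrow> nat \<Rightarrow> (int \<Rightarrow> complex) \<Rightarrow> (int \<Rightarrow> complex)" where
  "I_refl \<tau> M i f =
     (if i = 0 then fun_act M w_u (I_op \<tau> M (fun_act M w_u f)) else I_op \<tau> M f)"

text \<open>Reduced expressions are unique, so the choice is immaterial.\<close>
definition I_w :: "real \<Rightarrow> int \<Rightarrow> waff \<Rightarrow> (int \<Rightarrow> complex) \<Rightarrow> (int \<Rightarrow> complex)" where
  "I_w \<tau> M w f =
     (let (i0, js) = (SOME (i0, js). is_reduced_expr w i0 js)
      in (fun_act M w_u ^^ i0) (foldr (I_refl \<tau> M) js f))"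

definition \<J> :: "real \<Rightarrow> int \<Rightarrow> (int \<Rightarrow> complex) \<Rightarrow> (int \<Rightarrow> complex)" where
  "\<J> \<tau> M f = (\<lambda>n. of_real \<tau> powi (- int (w_len (w_min M n))) * I_w \<tau> M (w_min M n) f (n_plus M n))"

definition plane_wave :: "real \<Rightarrow> int \<Rightarrow> complex" where
  "plane_wave \<xi> = (\<lambda>n. exp (\<i> * of_real \<xi> * of_int n))"

definition \<phi> :: "real \<Rightarrow> int \<Rightarrow> real \<Rightarrow> int \<Rightarrow> complex" where
  "\<phi> \<tau> M \<xi> = (\<lambda>n. plane_wave \<xi> n + of_real \<tau> * I_op \<tau> M (plane_wave \<xi>) n)"

definition spherical :: "real \<Rightarrow> int \<Rightarrow> real \<Rightarrow> int \<Rightarrow> complex" where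
  "spherical \<tau> M \<xi> = \<J> \<tau> M (\<phi> \<tau> M \<xi>)"

subsection \<open>The spectral values\<close>

definition \<theta> :: "real \<Rightarrow> real \<Rightarrow> real" where
  "\<theta> \<tau> \<xi> = (1 - \<tau> ^ 4) * (LBINT x=0..2 * \<xi>. 1 / (1 + \<tau> ^ 4 - 2 * \<tau>\<^sup>2 * cos x))"

definition V :: "real \<Rightarrow> int \<Rightarrow> real \<Rightarrow> real" where
  "V \<tau> M \<xi> = of_int M * \<xi> + \<theta> \<tau> \<xi>"

definition spectral_value :: "real \<Rightarrow> int \<Rightarrow> int \<Rightarrow> real" where
  "spectral_value \<tau> M m = (THE \<xi>. V \<tau> M \<xi> = (of_int m + 1) * pi)"

end

theory Submission
  imports Defs
begin

text \<open>
  Put \<open>z = e\<^sup>i\<^sup>\<xi>\<close>. If \<open>z\<^sup>2 \<noteq> 1\<close>, the integral-reflection operator \<open>I\<close> acts explicitly on the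
  plane waves \<open>z\<^sup>n\<close> and \<open>z\<^sup>-\<^sup>n\<close>, and \<open>\<phi>\<close> is a combination \<open>A z\<^sup>n + B z\<^sup>-\<^sup>n\<close> with \<open>I \<phi> = \<tau> \<phi>\<close>.
  The equation \<open>V \<xi> = (m + 1) \<pi>\<close> is equivalent to the Bethe equation \<open>z\<^sup>M A = \<plusminus> B\<close>, which says
  that \<open>\<phi> (M - n) = \<plusminus> \<phi> n\<close>. Hence \<open>\<phi>\<close> is also an eigenfunction of \<open>u I u\<close> with eigenvalue \<open>\<tau>\<close>,
  so the factors \<open>\<tau>\<close> coming from \<open>I\<^sub>w\<close> cancel and the spherical function is the
  \<open>W\<^sub>S\<close>-invariant extension of \<open>\<phi>\<close> from \<open>\<Lambda> M\<close>. The eigenvalue equation is the recurrence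
  \<open>\<phi> (n + 1) + \<phi> (n - 1) = (z + z\<inverse>) \<phi> n\<close>, where at the ends of \<open>\<Lambda> M\<close> one uses
  \<open>\<phi> (-1) = \<tau>\<^sup>2 \<phi> 1\<close> and its mirror image.
\<close>

subsection \<open>The Weyl group\<close>

lemma w_act_mult: "w_act M (v \<otimes>\<^bsub>W\<^esub> w) n = w_act M v (w_act M w n)"
  unfolding W_def by simp (transfer, simp)

lemma w_act_one [simp]: "w_act M \<one>\<^bsub>W\<^esub> n = n"
  unfolding W_def by simp (transfer, simp)

lemma w_act_w_s [simp]: "w_act M w_s n = - n"
  by transfer simp

lemma w_act_w_u [simp]: "w_act M w_u n = M - n"
  by transfer simp

lemma w_act_w_refl: "w_act M (w_refl i) n = (if i = 0 then 2 * M - n else - n)"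
  by (simp add: w_refl_def w_act_mult)

lemma carrier_W [simp]: "carrier W = UNIV"
  by (simp add: W_def)

lemma w_s_square: "w_s \<otimes>\<^bsub>W\<^esub> w_s = \<one>\<^bsub>W\<^esub>"
proof -
  have "equivclp cancel ([] @ [GenS, GenS] @ []) ([] @ [])"
    by (intro r_into_equivclp cancel.intros)
  then show ?thesis
    unfolding W_def by simp (transfer, simp)
qed

lemma w_u_square: "w_u \<otimes>\<^bsub>W\<^esub> w_u = \<one>\<^bsub>W\<^esub>"
proof -
  have "equivclp cancel ([] @ [GenU, GenU] @ []) ([] @ [])"
    by (intro r_into_equivclp cancel.intros)
  then show ?thesis
    unfolding W_def by simp (transfer, simp)
qed

interpretation W: group W
  by (rule group_W)

lemma inv_w_s [simp]: "inv\<^bsub>W\<^esub> w_s = w_s"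
  by (rule W.inv_equality) (simp_all add: w_s_square)

lemma inv_w_u [simp]: "inv\<^bsub>W\<^esub> w_u = w_u"
  by (rule W.inv_equality) (simp_all add: w_u_square)

lemma inv_w_refl [simp]: "inv\<^bsub>W\<^esub> (w_refl i) = w_refl i"
  by (simp add: w_refl_def W.inv_mult_group W.m_assoc)

lemma subgroup_W_S: "subgroup W_S W"
  unfolding W_S_def by (rule W.generate_is_subgroup) simp

lemma w_refl_in_W_S: "i \<in> {0, 1} \<Longrightarrow> w_refl i \<in> W_S"
  unfolding W_S_def by (auto intro: generate.incl)

section \<open>Words in the two affine reflections\<close>

lemma is_expr_append:
  assumes "is_expr v 0 js" "is_expr w 0 ks"
  shows "is_expr (v \<otimes>\<^bsub>W\<^esub> w) 0 (js @ ks)"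
proof -
  define p where "p = (\<lambda>js. foldr (\<lambda>j v. w_refl j \<otimes>\<^bsub>W\<^esub> v) js)"
  \<comment> \<open>Changing the start value of the fold amounts to multiplication on the
    right.\<close>
  have "p js x = p js \<one>\<^bsub>W\<^esub> \<otimes>\<^bsub>W\<^esub> x" for x
    by (induction js) (simp_all add: p_def W.m_assoc)
  from this[of "p ks \<one>\<^bsub>W\<^esub>"] have "p (js @ ks) \<one>\<^bsub>W\<^esub> = p js \<one>\<^bsub>W\<^esub> \<otimes>\<^bsub>W\<^esub> p ks \<one>\<^bsub>W\<^esub>"
    by (simp add: p_def)
  with assms show ?thesis
    by (simp add: is_expr_def flip: p_def)
qed

lemma W_S_has_expr:
  assumes "w \<in> W_S"
  shows "\<exists>js. is_expr w 0 js"
  using assms unfolding W_S_def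
proof (induction rule: generate.induct)
  case one
  have "is_expr \<one>\<^bsub>W\<^esub> 0 []"
    by (simp add: is_expr_def)
  then show ?case ..
next
  case (incl h)
  then obtain i where "i \<in> {0, 1}" "h = w_refl i"
    by blast
  then have "is_expr h 0 [i]"
    by (auto simp: is_expr_def)
  then show ?case ..
next
  case (inv h)
  then obtain i where "i \<in> {0, 1}" "h = w_refl i"
    by blast
  then have "is_expr (inv\<^bsub>W\<^esub> h) 0 [i]"
    by (auto simp: is_expr_def)
  then show ?case ..
next
  case (eng h1 h2)
  then show ?case
    by (blast intro: is_expr_append)
qed

lemma W_S_has_reduced_expr:
  assumes "w \<in> W_S"
  shows "\<exists>i0 js. is_reduced_expr w i0 js"
proof -
  from W_S_has_expr[OF assms] have "\<exists>r i0 js. is_expr w i0 js \<and> length js = r"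
    by blast
  then have "\<exists>i0 js. is_expr w i0 js \<and> length js = w_len w"
    unfolding w_len_def by (rule LeastI_ex)
  then show ?thesis
    unfolding is_reduced_expr_def .
qed

text \<open>Induction over \<open>generate\<close> reduces invariance to the two generating
  reflections. It serves for parity, with \<open>M = 1\<close>, and for
  \<open>fold_\<Lambda>\<close>.\<close>

lemma invariant_w_act_W_S:
  assumes "w \<in> W_S"
    and "\<And>n. f (- n) = f n" "\<And>n. f (2 * M - n) = f n"
  shows "f (w_act M w n) = f n"
  using assms(1) unfolding W_S_def
proof (induction arbitrary: n rule: generate.induct)
  case (eng h1 h2)
  then show ?case
    by (simp add: w_act_mult)
qed (auto simp: w_act_w_refl assms(2,3))

text \<open>
  Acting with \<open>M = 1\<close>, the elements of \<open>W\<^sub>S\<close> preserve the parity of integers, whereas \<open>u\<close>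
  changes it.
\<close>
lemma W_S_expr_no_u:
  assumes "w \<in> W_S" "is_expr w i0 js"
  shows "i0 = 0"
proof -
  have "even (w_act 1 (foldr (\<lambda>j v. w_refl j \<otimes>\<^bsub>W\<^esub> v) js \<one>\<^bsub>W\<^esub>) 0)"
    by (induction js) (simp_all add: w_act_mult w_act_w_refl)
  moreover have "even (w_act 1 w 0)"
    using invariant_w_act_W_S[OF assms(1), of even 1 0] by simp
  ultimately show ?thesis
    using assms(2) by (auto simp: is_expr_def w_act_mult)
qed

text \<open>For positive \<open>M\<close> this is a closed form of \<open>n_plus\<close>: the
  reflections at 0 and \<open>M\<close> compose to the translation by \<open>2 * M\<close>, so an
  orbit is a residue class modulo \<open>2 * M\<close> up to sign.\<close>

definition fold_\<Lambda> :: "int \<Rightarrow> int \<Rightarrow> int" where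
  "fold_\<Lambda> M n = min (n mod (2 * M)) (2 * M - n mod (2 * M))"

context
  fixes M :: int
  assumes M: "M > 0"
begin

lemma fold_\<Lambda>_uminus: "fold_\<Lambda> M (- n) = fold_\<Lambda> M n"
  using M by (auto simp: fold_\<Lambda>_def zmod_zminus1_eq_if min_def)

lemma fold_\<Lambda>_reflect: "fold_\<Lambda> M (2 * M - n) = fold_\<Lambda> M n"
proof -
  have "(2 * M - n) mod (2 * M) = (- n) mod (2 * M)"
    using mod_add_self1[of "2 * M" "- n"] by simp
  then have "fold_\<Lambda> M (2 * M - n) = fold_\<Lambda> M (- n)"
    by (simp add: fold_\<Lambda>_def)
  then show ?thesis
    by (simp add: fold_\<Lambda>_uminus)
qed

lemma fold_\<Lambda>_W_S: "w \<in> W_S \<Longrightarrow> fold_\<Lambda> M (w_act M w n) = fold_\<Lambda> M n"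
  by (rule invariant_w_act_W_S) (auto simp: fold_\<Lambda>_uminus fold_\<Lambda>_reflect)

lemma fold_\<Lambda>_id: "n \<in> \<Lambda> M \<Longrightarrow> fold_\<Lambda> M n = n"
  using M by (auto simp: fold_\<Lambda>_def \<Lambda>_def)

text \<open>Descent on the absolute value: outside \<open>{-M..M}\<close> some element of
  \<open>W_S\<close> brings \<open>n\<close> closer to 0, and inside at most one sign change is left
  to do.\<close>

lemma W_S_orbit_meets_\<Lambda>: "\<exists>w\<in>W_S. w_act M w n \<in> \<Lambda> M"
proof (induction "nat \<bar>n\<bar>" arbitrary: n rule: less_induct)
  case less
  have refl: "w_refl i \<in> W_S" if "i \<in> {0, 1}" for i
    using w_refl_in_W_S that .
  have step: "\<exists>w\<in>W_S. w_act M w n \<in> \<Lambda> M"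
    if "v \<in> W_S" "\<bar>w_act M v n\<bar> < \<bar>n\<bar>" for v
  proof -
    have "nat \<bar>w_act M v n\<bar> < nat \<bar>n\<bar>"
      using that(2) by simp
    from less[OF this] obtain w where "w \<in> W_S" "w_act M w (w_act M v n) \<in> \<Lambda> M"
      by blast
    then have "w \<otimes>\<^bsub>W\<^esub> v \<in> W_S" "w_act M (w \<otimes>\<^bsub>W\<^esub> v) n \<in> \<Lambda> M"
      using that(1) subgroup.m_closed[OF subgroup_W_S] by (auto simp: w_act_mult)
    then show ?thesis
      by blast
  qed
  consider "n \<in> \<Lambda> M" | "n > M" | "n < - M" | "- M \<le> n" "n < 0"
    unfolding \<Lambda>_def by fastforce
  then show ?case
  proof cases
    case 1
    then show ?thesis
      using subgroup.one_closed[OF subgroup_W_S] by (auto intro: bexI[of _ "\<one>\<^bsub>W\<^esub>"])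
  next
    case 2
    then show ?thesis
      using M by (intro step[of "w_refl 0"] refl) (auto simp: w_act_w_refl)
  next
    case 3
    then show ?thesis
      \<comment> \<open>The product acts as the translation to \<open>2 * M + n\<close>.\<close>
      using M by (intro step[of "w_refl 0 \<otimes>\<^bsub>W\<^esub> w_refl 1"]
        subgroup.m_closed[OF subgroup_W_S] refl) (auto simp: w_act_w_refl w_act_mult)
  next
    case 4
    then show ?thesis
      using refl[of 1] by (intro bexI[of _ "w_refl 1"]) (auto simp: w_act_w_refl \<Lambda>_def)
  qed
qed

text \<open>The fold is constant on orbits and the identity on \<open>\<Lambda> M\<close>, so any
  point of the orbit in \<open>\<Lambda> M\<close> is the folded one.\<close>

lemma w_min_in_W_S_and_n_plus: "w_min M n \<in> W_S" "n_plus M n = fold_\<Lambda> M n"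
proof -
  obtain w where "w \<in> W_S \<and> w_act M w n \<in> \<Lambda> M"
    using W_S_orbit_meets_\<Lambda> by blast
  then have *: "w_min M n \<in> W_S \<and> w_act M (w_min M n) n \<in> \<Lambda> M"
    unfolding w_min_def by (rule arg_min_natI)
  then show "w_min M n \<in> W_S" ..
  from * show "n_plus M n = fold_\<Lambda> M n"
    unfolding n_plus_def using fold_\<Lambda>_W_S fold_\<Lambda>_id by metis
qed

end

subsection \<open>Joint eigenfunctions of the reflection operators\<close>

text \<open>Each letter of a reduced expression multiplies \<open>f\<close> by \<tau>, and the
  prefactor of \<open>\<J>\<close> cancels the resulting power of exponent \<open>w_len w\<close>.
  What remains is evaluation at \<open>n_plus\<close>.\<close>

lemma \<J>_joint_eigenfunction:
  assumes "M > 0" "\<tau> \<noteq> 0"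
    and eigen: "\<And>i. i \<in> {0, 1} \<Longrightarrow> I_refl \<tau> M i f = (\<lambda>n. of_real \<tau> * f n)"
    and lin: "\<And>i c. I_refl \<tau> M i (\<lambda>n. c * f n) = (\<lambda>n. c * I_refl \<tau> M i f n)"
  shows "\<J> \<tau> M f n = f (fold_\<Lambda> M n)"
proof -
  define w where "w = w_min M n"
  have w: "w \<in> W_S"
    unfolding w_def using w_min_in_W_S_and_n_plus(1)[OF assms(1)] .
  have *: "foldr (I_refl \<tau> M) js f = (\<lambda>n. of_real \<tau> ^ length js * f n)"
    if "set js \<subseteq> {0, 1}" for js
    using that
  proof (induction js)
    case (Cons j js)
    then show ?case
      using eigen[of j] lin by (auto simp: mult.assoc mult.left_commute)
  qed simp
  \<comment> \<open>Any reduced expression serves: its length and the absence of \<open>u\<close>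
    matter, the order of its letters does not.\<close>
  define p where "p = (SOME (i0, js). is_reduced_expr w i0 js)"
  have "\<exists>p. case p of (i0, js) \<Rightarrow> is_reduced_expr w i0 js"
    using W_S_has_reduced_expr[OF w] by auto
  then have "case p of (i0, js) \<Rightarrow> is_reduced_expr w i0 js"
    unfolding p_def by (rule someI_ex)
  then obtain i0 js where p: "p = (i0, js)" and red: "is_reduced_expr w i0 js"
    by (cases p) auto
  then have "i0 = 0" "set js \<subseteq> {0, 1}" "length js = w_len w"
    using W_S_expr_no_u[OF w] by (auto simp: is_reduced_expr_def is_expr_def)
  then have "I_w \<tau> M w f = (\<lambda>n. of_real \<tau> ^ w_len w * f n)"
    using * by (simp add: I_w_def flip: p_def) (simp add: p)
  then show ?thesis
    using w_min_in_W_S_and_n_plus(2)[OF assms(1)] assms(2)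
    by (simp add: \<J>_def power_int_minus flip: w_def)
qed

section \<open>Integral reflections on plane waves\<close>

lemma J_op_scale: "J_op (\<lambda>n. c * f n) n = c * J_op f n"
  by (simp add: J_op_def sum_distrib_left)

lemma J_op_add: "J_op (\<lambda>n. f n + g n) n = J_op f n + J_op g n"
  by (simp add: J_op_def sum.distrib)

lemma fun_act_w_s: "fun_act M w_s f = (\<lambda>n. f (- n))"
  by (simp add: fun_act_def)

lemma fun_act_w_u: "fun_act M w_u f = (\<lambda>n. f (M - n))"
  by (simp add: fun_act_def)

lemma I_op_scale: "I_op \<tau> M (\<lambda>n. c * f n) = (\<lambda>n. c * I_op \<tau> M f n)"
  by (simp add: I_op_def fun_act_w_s J_op_scale fun_eq_iff algebra_simps)

lemma I_refl_scale: "I_refl \<tau> M i (\<lambda>n. c * f n) = (\<lambda>n. c * I_refl \<tau> M i f n)"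
  by (simp add: I_refl_def fun_act_w_u I_op_scale)

text \<open>For \<open>i = 0\<close> the two applications of \<open>u\<close> contribute one factor
  \<open>c\<close> each, and these cancel.\<close>

lemma I_refl_eigenfunction:
  assumes "I_op \<tau> M f = (\<lambda>n. of_real \<tau> * f n)" "\<And>n. f (M - n) = c * f n" "c * c = 1"
  shows "I_refl \<tau> M i f = (\<lambda>n. of_real \<tau> * f n)"
  using assms by (simp add: I_refl_def fun_act_w_u I_op_scale mult.left_commute)
    (simp add: mult.assoc[symmetric])

text \<open>\<open>J_op\<close> sums a geometric progression of ratio \<open>z^2\<close>, which
  telescopes after multiplication by \<open>z^2 - 1\<close>. Both signs of \<open>n\<close> lead to
  the same formula.\<close>

lemma J_op_power_int:
  fixes z :: complex
  assumes "z \<noteq> 0" "z\<^sup>2 \<noteq> 1"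
  shows "J_op (\<lambda>n. z powi n) n = (z powi (- n) - z powi n) / (z\<^sup>2 - 1)"
proof -
  \<comment> \<open>The exponent \<open>a\<close> is kept apart from the number of terms
    \<open>m\<close> so that it stays fixed in the induction; later \<open>a = n\<close> and
    \<open>m\<close> is the absolute value of \<open>n\<close>.\<close>
  have down: "(z\<^sup>2 - 1) * (\<Sum>k\<in>{1..int m}. z powi (a - 2 * k)) = z powi a - z powi (a - 2 * int m)"
    for a m
  proof (induction m)
    case (Suc m)
    have "{1..int (Suc m)} = insert (int (Suc m)) {1..int m}"
      by auto
    moreover have "z powi (a - 2 * int m) = z powi (a - 2 * int (Suc m)) * z\<^sup>2"
      using assms(1) power_int_add[of z "a - 2 * int (Suc m)" 2] by (simp add: algebra_simps)
    ultimately show ?case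
      using Suc by (simp add: algebra_simps)
  qed simp
  have up: "(z\<^sup>2 - 1) * (\<Sum>k\<in>{0..<int m}. z powi (a + 2 * k)) = z powi (a + 2 * int m) - z powi a"
    for a m
  proof (induction m)
    case (Suc m)
    have "{0..<int (Suc m)} = insert (int m) {0..<int m}"
      by auto
    moreover have "z powi (a + 2 * int (Suc m)) = z powi (a + 2 * int m) * z\<^sup>2"
      using assms(1) power_int_add[of z "a + 2 * int m" 2] by (simp add: algebra_simps)
    ultimately show ?case
      using Suc by (simp add: algebra_simps)
  qed simp
  have nz: "z\<^sup>2 - 1 \<noteq> 0"
    using assms(2) by simp
  consider "n > 0" | "n < 0" | "n = 0"
    by linarith
  then show ?thesis
  proof cases
    case 1
    then show ?thesis
      using down[where m = "nat n" and a = n] nz by (simp add: J_op_def nonzero_eq_divide_eq algebra_simps)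
  next
    case 2
    then show ?thesis
      using up[where m = "nat (- n)" and a = n] nz by (simp add: J_op_def nonzero_eq_divide_eq algebra_simps)
  next
    case 3
    then show ?thesis
      by (simp add: J_op_def)
  qed
qed

lemma plane_wave_eq: "plane_wave \<xi> = (\<lambda>n. cis \<xi> powi n)"
  by (simp add: plane_wave_def cis_conv_exp exp_power_int mult_ac)

lemma \<phi>_0: "\<phi> \<tau> M \<xi> 0 = 1 + of_real (\<tau>\<^sup>2)"
  by (simp add: \<phi>_def plane_wave_def I_op_def fun_act_w_s J_op_def power2_eq_square)

text \<open>\<open>A\<close> and \<open>B\<close> are the values of the c-function at \<xi> and
  \<open>-\<xi>\<close>, expanded by powers of \<open>z\<close>. The condition on \<open>z\<close>
  excludes integer multiples of \<open>pi\<close>.\<close>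

locale wave_pair =
  fixes \<tau> \<xi> :: real and M :: int and z A B :: complex
  assumes \<tau>: "\<tau> \<noteq> 0" and z2: "z\<^sup>2 \<noteq> 1"
    and z_def: "z = cis \<xi>"
    and A_def: "A = (z\<^sup>2 - of_real (\<tau>\<^sup>2)) / (z\<^sup>2 - 1)"
    and B_def: "B = (of_real (\<tau>\<^sup>2) * z\<^sup>2 - 1) / (z\<^sup>2 - 1)"
begin

lemma z_nz: "z \<noteq> 0"
  by (simp add: z_def)

lemma J_op_power_int_neg: "J_op (\<lambda>n. z powi (- n)) n = z\<^sup>2 * (z powi (- n) - z powi n) / (z\<^sup>2 - 1)"
proof -
  have "(inverse z)\<^sup>2 \<noteq> 1"
    using z2 z_nz by (auto simp: power2_eq_square field_simps)
  moreover have inv: "inverse z powi n = z powi (- n)" for n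
    by (metis power_int_inverse power_int_minus)
  ultimately have "J_op (\<lambda>n. z powi (- n)) n = (z powi n - z powi (- n)) / ((inverse z)\<^sup>2 - 1)"
    using J_op_power_int[of "inverse z" n] z_nz
    by (simp only: inv minus_minus nonzero_imp_inverse_nonzero simp_thms)
  also have "\<dots> = z\<^sup>2 * (z powi (- n) - z powi n) / (z\<^sup>2 - 1)"
  proof -
    have "z\<^sup>2 - 1 \<noteq> 0" "(inverse z)\<^sup>2 - 1 \<noteq> 0"
      using z2 \<open>(inverse z)\<^sup>2 \<noteq> 1\<close> by auto
    moreover have "z\<^sup>2 * (inverse z)\<^sup>2 = 1"
      using z_nz by (simp flip: power_mult_distrib)
    ultimately show ?thesis
      by (simp add: frac_eq_eq) algebra
  qed
  finally show ?thesis .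
qed

lemma \<phi>_eq: "\<phi> \<tau> M \<xi> = (\<lambda>n. A * z powi n + B * z powi (- n))"
proof
  fix n
  have "of_real \<tau> * (of_real (\<tau> - inverse \<tau>) :: complex) = of_real (\<tau>\<^sup>2) - 1"
    using \<tau> by (simp add: power2_eq_square right_diff_distrib flip: of_real_mult)
  then have "\<phi> \<tau> M \<xi> n = z powi n + of_real (\<tau>\<^sup>2) * z powi (- n) +
    (of_real (\<tau>\<^sup>2) - 1) * ((z powi (- n) - z powi n) / (z\<^sup>2 - 1))"
    by (simp add: \<phi>_def plane_wave_eq I_op_def fun_act_w_s J_op_power_int[OF z_nz z2]
      ring_distribs power2_eq_square flip: z_def mult.assoc)
  also have "\<dots> = A * z powi n + B * z powi (- n)"
    using z2 by (simp add: A_def B_def divide_simps) algebra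
  finally show "\<phi> \<tau> M \<xi> n = A * z powi n + B * z powi (- n)" .
qed

text \<open>This is the quadratic Hecke relation \<open>(I - \<tau>) (I + 1/\<tau>) = 0\<close>
  applied to the plane wave, checked by computing with the coefficients \<open>A\<close> and
  \<open>B\<close>.\<close>

lemma I_op_\<phi>: "I_op \<tau> M (\<phi> \<tau> M \<xi>) = (\<lambda>n. of_real \<tau> * \<phi> \<tau> M \<xi> n)"
proof
  fix n
  define x where "x = z powi n"
  define y where "y = z powi (- n)"
  have J: "J_op (\<phi> \<tau> M \<xi>) n = (A + z\<^sup>2 * B) * (y - x) / (z\<^sup>2 - 1)"
    using z2 by (simp add: \<phi>_eq J_op_add J_op_scale J_op_power_int[OF z_nz z2]
      J_op_power_int_neg x_def y_def divide_simps) algebra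
  \<comment> \<open>The numerator contains \<open>z^2 - 1\<close>, so this sum is
    \<open>\<tau>^2 * (z^2 + 1)\<close>; its factor \<open>\<tau>^2\<close> absorbs the inverse of
    \<tau> in front of \<open>J_op\<close>.\<close>
  have "A + z\<^sup>2 * B = (z\<^sup>2 - of_real (\<tau>\<^sup>2) + z\<^sup>2 * (of_real (\<tau>\<^sup>2) * z\<^sup>2 - 1)) / (z\<^sup>2 - 1)"
    by (simp add: A_def B_def add_divide_distrib)
  also have "z\<^sup>2 - of_real (\<tau>\<^sup>2) + z\<^sup>2 * (of_real (\<tau>\<^sup>2) * z\<^sup>2 - 1) =
    of_real (\<tau>\<^sup>2) * (z\<^sup>2 + 1) * (z\<^sup>2 - 1)"
    by algebra
  also have "\<dots> / (z\<^sup>2 - 1) = of_real (\<tau>\<^sup>2) * (z\<^sup>2 + 1)"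
    by (rule nonzero_mult_div_cancel_right) (use z2 in simp)
  finally have "of_real (\<tau> - inverse \<tau>) * J_op (\<phi> \<tau> M \<xi>) n =
    of_real ((\<tau> - inverse \<tau>) * \<tau>\<^sup>2) * ((z\<^sup>2 + 1) * (y - x) / (z\<^sup>2 - 1))"
    by (simp add: J)
  also have "(\<tau> - inverse \<tau>) * \<tau>\<^sup>2 = \<tau> * (\<tau>\<^sup>2 - 1)"
    using \<tau> by (simp add: field_simps power2_eq_square)
  finally have "I_op \<tau> M (\<phi> \<tau> M \<xi>) n = of_real \<tau> * (A * y + B * x +
    (of_real (\<tau>\<^sup>2) - 1) * (z\<^sup>2 + 1) * (y - x) / (z\<^sup>2 - 1))"
    by (simp add: I_op_def fun_act_w_s \<phi>_eq x_def y_def algebra_simps)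
  also have "A * y + B * x + (of_real (\<tau>\<^sup>2) - 1) * (z\<^sup>2 + 1) * (y - x) / (z\<^sup>2 - 1) = A * x + B * y"
    using z2 by (simp add: A_def B_def divide_simps) algebra
  finally show "I_op \<tau> M (\<phi> \<tau> M \<xi>) n = of_real \<tau> * \<phi> \<tau> M \<xi> n"
    by (simp add: \<phi>_eq x_def y_def)
qed

lemma \<phi>_recurrence:
  "\<phi> \<tau> M \<xi> (n + 1) + \<phi> \<tau> M \<xi> (n - 1) = of_real (2 * cos \<xi>) * \<phi> \<tau> M \<xi> n"
proof -
  have "of_real (2 * cos \<xi>) = z + inverse z"
    by (simp add: z_def cis_inverse complex_eq_iff)
  moreover have "z powi (- n - 1) = z powi (- n) * inverse z" "z powi (- n + 1) = z powi (- n) * z"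
    "z powi (n - 1) = z powi n * inverse z" "z powi (n + 1) = z powi n * z"
    using z_nz power_int_diff[of z "- n" 1] power_int_add[of z "- n" 1]
      power_int_diff[of z n 1] power_int_add[of z n 1]
    by (simp_all add: divide_inverse)
  moreover have "- (n + 1) = - n - 1" "- (n - 1) = - n + 1"
    by auto
  ultimately show ?thesis
    by (simp only: \<phi>_eq) (simp add: algebra_simps)
qed

text \<open>Conjugation inverts the unimodular \<open>z\<close>, hence exchanges \<open>A\<close>
  with \<open>B\<close> and the two waves with each other.\<close>

lemma \<phi>_real: "\<phi> \<tau> M \<xi> n \<in> \<real>"
proof -
  define w where "w = inverse z"
  have cz: "cnj z = w"
    by (simp add: w_def z_def cis_cnj cis_inverse)
  have wz: "w\<^sup>2 * z\<^sup>2 = 1"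
    using z_nz by (simp add: w_def flip: power_mult_distrib)
  with z2 have "w\<^sup>2 - 1 \<noteq> 0" "z\<^sup>2 - 1 \<noteq> 0"
    by auto
  with wz have "cnj A = B"
    by (simp add: A_def B_def cz frac_eq_eq) algebra
  then have "cnj B = A"
    by auto
  moreover have "cnj (z powi k) = z powi (- k)" for k
    by (simp add: cz w_def) (metis power_int_inverse power_int_minus)
  ultimately have "cnj (\<phi> \<tau> M \<xi> n) = \<phi> \<tau> M \<xi> n"
    using \<open>cnj A = B\<close> by (simp add: \<phi>_eq)
  then show ?thesis
    by (simp add: Reals_cnj_iff)
qed

text \<open>Division by \<open>z^2 - 1\<close> turns the hypothesis into
  \<open>z powi M * A = \<epsilon> * B\<close>. As \<epsilon> is its own inverse, also
  \<open>z powi (-M) * B = \<epsilon> * A\<close>, so the reflection swaps the two terms up to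
  \<epsilon>.\<close>

lemma \<phi>_reflect:
  assumes bethe: "z powi M * (z\<^sup>2 - of_real (\<tau>\<^sup>2)) = \<epsilon> * (of_real (\<tau>\<^sup>2) * z\<^sup>2 - 1)"
    and "\<epsilon> * \<epsilon> = 1"
  shows "\<phi> \<tau> M \<xi> (M - n) = \<epsilon> * \<phi> \<tau> M \<xi> n"
proof -
  have "z powi M * A = \<epsilon> * B"
    using bethe by (simp add: A_def B_def)
  moreover have "z powi (- M) * z powi M = 1"
    using z_nz by (simp add: power_int_minus)
  ultimately have "z powi M * A = \<epsilon> * B" "z powi (- M) * B = \<epsilon> * A"
    using assms(2) by (blast, algebra)
  moreover have "z powi (M - n) = z powi M * z powi (- n)" "z powi (- (M - n)) = z powi (- M) * z powi n"
    using z_nz by (simp_all flip: power_int_add)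
  ultimately show ?thesis
    by (simp only: \<phi>_eq) algebra
qed

end

text \<open>Off the multiples of \<open>M\<close> the fold is locally a translation or a reflection,
  and the recurrence carries over. At a multiple of \<open>M\<close> both neighbours fold to the
  same point and exactly one coefficient is \<open>\<tau>^2\<close>; \<open>left\<close> and
  \<open>right\<close> turn this into the recurrence at 0 and at \<open>M\<close>.\<close>

lemma laplacian_invariant_extension:
  fixes f :: "int \<Rightarrow> complex"
  assumes M: "M > 1"
    and rec: "\<And>n. f (n + 1) + f (n - 1) = c * f n"
    and left: "f (-1) = of_real (\<tau>\<^sup>2) * f 1"
    and right: "f (M + 1) = of_real (\<tau>\<^sup>2) * f (M - 1)"
  shows "laplacian \<tau> M (\<lambda>n. f (fold_\<Lambda> M n)) n = c * f (fold_\<Lambda> M n)"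
proof -
  define r where "r = n mod (2 * M)"
  define k where "k = n div (2 * M)"
  have n: "n = 2 * M * k + r"
    by (simp add: r_def k_def)
  have r: "0 \<le> r" "r < 2 * M"
    using M by (simp_all add: r_def)
  have fold: "fold_\<Lambda> M (2 * M * k + j) = fold_\<Lambda> M j" for j
    by (simp add: fold_\<Lambda>_def)
  have fold': "fold_\<Lambda> M j = (if j \<le> M then j else 2 * M - j)" if "0 \<le> j" "j < 2 * M" for j
    using that by (auto simp: fold_\<Lambda>_def)
  have up: "fold_\<Lambda> M (n + 1) = fold_\<Lambda> M (r + 1)" and down: "fold_\<Lambda> M (n - 1) = fold_\<Lambda> M (r - 1)"
    and same: "fold_\<Lambda> M n = fold_\<Lambda> M r"
    using fold[of "r + 1"] fold[of "r - 1"] fold[of r] by (simp_all add: n algebra_simps)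
  have neg: "fold_\<Lambda> M (-1) = 1"
    using fold_\<Lambda>_uminus[of M 1] fold'[of 1] M by simp
  have zero: "c * f 0 = f 1 + of_real (\<tau>\<^sup>2) * f 1"
    using rec[of 0] left by simp
  have end_M: "c * f M = of_real (\<tau>\<^sup>2) * f (M - 1) + f (M - 1)"
    using rec[of M] right by simp
  consider "r = 0" | "r = M" | "0 < r" "r < M" | "M < r" "r < 2 * M"
    using r by linarith
  then show ?thesis
  proof cases
    case 1
    have n': "n = M * (2 * k)"
      using n 1 by simp
    have mem: "n \<in> {M * k | k. k > 0} \<longleftrightarrow> k > 0" "n \<in> {M * k | k. k \<le> 0} \<longleftrightarrow> k \<le> 0"
      using M n' by auto
    show ?thesis
      unfolding laplacian_def mem up down same
      using 1 M zero by (cases "k > 0") (simp_all add: neg fold')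
  next
    case 2
    have n': "n = M * (2 * k + 1)"
      using n 2 by (simp add: algebra_simps)
    \<comment> \<open>The multiplier \<open>2 * k + 1\<close> is already positive for
      \<open>k = 0\<close>, unlike \<open>2 * k\<close> in the previous case.\<close>
    have mem: "n \<in> {M * k | k. k > 0} \<longleftrightarrow> k \<ge> 0" "n \<in> {M * k | k. k \<le> 0} \<longleftrightarrow> k < 0"
      using M n' by auto
    show ?thesis
      unfolding laplacian_def mem up down same
      using 2 M end_M by (cases "k \<ge> 0") (simp_all add: fold')
  next
    case 3
    have "\<not> M dvd n"
    proof
      assume "M dvd n"
      then have "M dvd r"
        using n by (metis dvd_add_right_iff dvd_triv_right mult.assoc mult.commute)
      with 3 show False
        using zdvd_not_zless by blast
    qed
    then have mem: "n \<in> {M * k | k. k > 0} \<longleftrightarrow> False" "n \<in> {M * k | k. k \<le> 0} \<longleftrightarrow> False"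
      by auto
    show ?thesis
      unfolding laplacian_def mem up down same using 3 rec[of r] by (simp add: fold')
  next
    case 4
    have "\<not> M dvd n"
    proof
      assume "M dvd n"
      then have "M dvd r - M"
        using n by (metis dvd_add_right_iff dvd_triv_right dvd_diff dvd_refl mult.assoc mult.commute)
      with 4 show False
        using zdvd_not_zless[of "r - M" M] by simp
    qed
    then have mem: "n \<in> {M * k | k. k > 0} \<longleftrightarrow> False" "n \<in> {M * k | k. k \<le> 0} \<longleftrightarrow> False"
      by auto
    have "fold_\<Lambda> M (r + 1) = 2 * M - r - 1"
      \<comment> \<open>If \<open>r + 1 = 2 * M\<close>, the residue wraps around to 0, outside the
        range of \<open>fold'\<close>.\<close>
      using 4 M by (cases "r + 1 = 2 * M") (simp_all add: fold', simp add: fold_\<Lambda>_def)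
    moreover have "fold_\<Lambda> M (r - 1) = 2 * M - r + 1"
      using 4 M by (simp add: fold')
    ultimately show ?thesis
      unfolding laplacian_def mem up down same
      using 4 rec[of "2 * M - r"] by (simp add: fold' add.commute)
  qed
qed

text \<open>At each end the coefficient \<open>\<tau>^2\<close> belongs to the neighbour outside
  \<open>\<Lambda> M\<close>. Identifying that neighbour with its mirror image gives
  \<open>1 + \<tau>^2\<close>.\<close>

lemma laplacian_\<Lambda>_restrict:
  assumes "M > 1" "f (-1) = f 1" "f (M + 1) = f (M - 1)"
  shows "laplacian_\<Lambda> \<tau> M (restrict f (\<Lambda> M)) = restrict (laplacian \<tau> M f) (\<Lambda> M)"
proof
  fix n
  show "laplacian_\<Lambda> \<tau> M (restrict f (\<Lambda> M)) n = restrict (laplacian \<tau> M f) (\<Lambda> M) n"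
  proof (cases "n \<in> \<Lambda> M")
    case True
    then consider "n = 0" | "n = M" | "0 < n" "n < M"
      by (force simp: \<Lambda>_def)
    then show ?thesis
    proof cases
      case 1
      then show ?thesis
        using assms by (auto simp: laplacian_\<Lambda>_def laplacian_def \<Lambda>_def algebra_simps)
    next
      case 2
      have "M \<in> {M * k | k. k > 0}" "M \<notin> {M * k | k. k \<le> 0}"
        using assms(1) by (auto intro: exI[of _ 1] simp: mult_eq_self_implies_10)
      then show ?thesis
        using 2 assms by (auto simp: laplacian_\<Lambda>_def laplacian_def \<Lambda>_def algebra_simps)
    next
      case 3
      then have "\<not> M dvd n"
        using zdvd_not_zless by blast
      then have "n \<notin> {M * k | k. k > 0}" "n \<notin> {M * k | k. k \<le> 0}"
        by auto
      then show ?thesis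
        using 3 assms by (auto simp: laplacian_\<Lambda>_def laplacian_def \<Lambda>_def)
    qed
  qed (simp add: laplacian_\<Lambda>_def)
qed

subsection \<open>The spectral values\<close>

lemma one_minus_mult_cos_pos:
  fixes q :: real
  assumes "0 < q" "q < 1"
  shows "1 - q * cos x > 0"
proof -
  have "q * cos x \<le> q"
    using assms by (intro mult_left_le) auto
  then show ?thesis
    using assms by linarith
qed

text \<open>Both sides are the squared modulus of \<open>1 - q * cis x\<close>.\<close>

lemma poisson_denominator:
  fixes q x :: real
  shows "1 + q\<^sup>2 - 2 * q * cos x = (1 - q * cos x)\<^sup>2 + (q * sin x)\<^sup>2"
  using sin_cos_squared_add[of x] by algebra

text \<open>For \<open>0 < q < 1\<close> this is the continuous argument, vanishing at 0, of
  \<open>(cis x - q) / (1 - q * cis x)\<close>. The denominator has positive real part, so one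
  branch of \<open>arctan\<close> suffices.\<close>

definition \<theta>_arctan :: "real \<Rightarrow> real \<Rightarrow> real" where
  "\<theta>_arctan q x = x + 2 * arctan (q * sin x / (1 - q * cos x))"

context
  fixes q :: real
  assumes q: "0 < q" "q < 1"
begin

lemma poisson_denominator_pos: "1 + q\<^sup>2 - 2 * q * cos x > 0"
  unfolding poisson_denominator using one_minus_mult_cos_pos[OF q, of x]
  by (intro add_pos_nonneg) auto

lemma \<theta>_arctan_deriv:
  "(\<theta>_arctan q has_real_derivative (1 - q\<^sup>2) / (1 + q\<^sup>2 - 2 * q * cos x)) (at x)"
proof -
  define d where "d = 1 - q * cos x"
  define e where "e = q * sin x"
  have d: "d > 0"
    unfolding d_def using one_minus_mult_cos_pos[OF q] .
  \<comment> \<open>In \<open>d\<close> and \<open>e\<close> the derivative is a rational function,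
    and \<open>sin^2 + cos^2 = 1\<close> becomes this relation.\<close>
  have sc: "e * e = q\<^sup>2 - (1 - d) * (1 - d)"
    unfolding d_def e_def using sin_cos_squared_add[of x] by algebra
  have D: "(\<theta>_arctan q has_real_derivative
    1 + 2 * (((1 - d) * d - e * e) / (d * d) * inverse (1 + (e / d)\<^sup>2))) (at x)"
    unfolding \<theta>_arctan_def[abs_def] using d
    by (auto intro!: derivative_eq_intros simp: d_def e_def)
  have S: "1 + q\<^sup>2 - 2 * q * cos x = d * d + e * e"
    unfolding poisson_denominator d_def e_def by (simp add: power2_eq_square)
  have pos: "d * d + e * e > 0"
    using d by (simp add: add_pos_nonneg)
  have "inverse (1 + (e / d)\<^sup>2) = d * d / (d * d + e * e)"
    using d pos by (simp add: field_simps power2_eq_square)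
  then have "1 + 2 * (((1 - d) * d - e * e) / (d * d) * inverse (1 + (e / d)\<^sup>2)) =
    1 + 2 * ((1 - d) * d - e * e) / (d * d + e * e)"
    using d by simp
  also have "\<dots> = (d * d + e * e + 2 * ((1 - d) * d - e * e)) / (d * d + e * e)"
    by (subst add_divide_distrib) (use pos d in simp)
  also have "d * d + e * e + 2 * ((1 - d) * d - e * e) = 1 - q\<^sup>2"
    unfolding sc by algebra
  finally show ?thesis
    using D S by simp
qed

lemma \<theta>_arctan_integral:
  "(1 - q\<^sup>2) * (LBINT x=0..y. 1 / (1 + q\<^sup>2 - 2 * q * cos x)) = \<theta>_arctan q y"
proof -
  have nz: "1 + q\<^sup>2 - 2 * q * cos x \<noteq> 0" for x
    using poisson_denominator_pos[of x] by linarith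
  have "(LBINT x=ereal 0..ereal y. (1 - q\<^sup>2) / (1 + q\<^sup>2 - 2 * q * cos x)) =
    \<theta>_arctan q y - \<theta>_arctan q 0"
  proof (rule interval_integral_FTC_finite)
    show "continuous_on {min 0 y..max 0 y} (\<lambda>x. (1 - q\<^sup>2) / (1 + q\<^sup>2 - 2 * q * cos x))"
      using nz by (intro continuous_intros) auto
    show "(\<theta>_arctan q has_vector_derivative (1 - q\<^sup>2) / (1 + q\<^sup>2 - 2 * q * cos x))
      (at x within {min 0 y..max 0 y})" if "min 0 y \<le> x" "x \<le> max 0 y" for x
      using \<theta>_arctan_deriv[of x]
      by (simp add: has_real_derivative_iff_has_vector_derivative has_vector_derivative_at_within)
  qed
  moreover have "\<theta>_arctan q 0 = 0"
    by (simp add: \<theta>_arctan_def)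
  ultimately show ?thesis
    using interval_lebesgue_integral_mult_right[of lborel 0 "ereal y" "1 - q\<^sup>2"
        "\<lambda>x. 1 / (1 + q\<^sup>2 - 2 * q * cos x)"]
    by (simp add: zero_ereal_def)
qed

text \<open>In polar form \<open>1 - q * cis x\<close> is \<open>r * cis (- arctan t)\<close>, and
  its conjugate has the opposite angle. The factor \<open>cis (2 * arctan t)\<close> therefore
  carries the first into the second.\<close>

lemma cis_\<theta>_arctan: "cis (\<theta>_arctan q x) * (1 - of_real q * cis x) = cis x - of_real q"
proof -
  define t where "t = q * sin x / (1 - q * cos x)"
  define r where "r = (1 - q * cos x) / cos (arctan t)"
  have c: "cos (arctan t) > 0"
    using arctan[of t] cos_gt_zero_pi by blast
  have "r * sin (arctan t) = (1 - q * cos x) * tan (arctan t)"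
    by (simp add: r_def tan_def)
  also have "\<dots> = q * sin x"
    using one_minus_mult_cos_pos[OF q, of x] by (simp add: tan_arctan t_def)
  finally have s: "r * sin (arctan t) = q * sin x" .
  have "r * cos (arctan t) = 1 - q * cos x"
    using c by (simp add: r_def)
  with s have 1: "1 - of_real q * cis x = of_real r * cis (- arctan t)"
    and 2: "1 - of_real q * cis (- x) = of_real r * cis (arctan t)"
    by (simp_all add: complex_eq_iff)
  have "cis (\<theta>_arctan q x) * (1 - of_real q * cis x) =
    cis x * (of_real r * (cis (2 * arctan t) * cis (- arctan t)))"
    unfolding 1 \<theta>_arctan_def t_def by (simp flip: cis_mult)
  also have "\<dots> = cis x * (1 - of_real q * cis (- x))"
    unfolding 2 by (simp add: cis_mult)
  also have "\<dots> = cis x - of_real q"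
    by (simp add: right_diff_distrib cis_mult mult.left_commute)
  finally show ?thesis .
qed

end

section \<open>Monotonicity of \<open>V\<close> and the Bethe equation\<close>

context
  fixes \<tau> :: real and M m :: int
  assumes \<tau>: "0 < \<tau>" "\<tau> < 1" and M: "M > 1" and m: "m \<in> \<Lambda> M"
begin

lemma \<tau>2: "0 < \<tau>\<^sup>2" "\<tau>\<^sup>2 < 1"
  using \<tau> by (auto simp: power_less_one_iff)

lemma V_eq: "V \<tau> M \<xi> = of_int M * \<xi> + \<theta>_arctan (\<tau>\<^sup>2) (2 * \<xi>)"
  using \<theta>_arctan_integral[OF \<tau>2, of "2 * \<xi>"]
  by (simp add: V_def \<theta>_def power2_eq_square power4_eq_xxxx mult.assoc)

lemma V_deriv: "\<exists>D>0. (V \<tau> M has_real_derivative D) (at \<xi>)"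
proof -
  define D where "D = (1 - (\<tau>\<^sup>2)\<^sup>2) / (1 + (\<tau>\<^sup>2)\<^sup>2 - 2 * \<tau>\<^sup>2 * cos (2 * \<xi>))"
  have "(\<tau>\<^sup>2)\<^sup>2 < 1"
    using \<tau>2 by (subst abs_square_less_1) auto
  then have "D > 0"
    unfolding D_def using poisson_denominator_pos[OF \<tau>2] by simp
  moreover have "((\<lambda>\<xi>. \<theta>_arctan (\<tau>\<^sup>2) (2 * \<xi>)) has_real_derivative D * 2) (at \<xi>)"
    unfolding D_def
    by (rule DERIV_chain2[OF \<theta>_arctan_deriv[OF \<tau>2]]) (auto intro!: derivative_eq_intros)
  then have "(V \<tau> M has_real_derivative of_int M + D * 2) (at \<xi>)"
    unfolding V_eq[abs_def] by (auto intro!: derivative_eq_intros)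
  ultimately show ?thesis
    using M by (intro exI[of _ "of_int M + D * 2"]) auto
qed

lemma V_strict_mono: "strict_mono (V \<tau> M)"
proof (rule strict_monoI)
  fix x y :: real
  assume "x < y"
  then show "V \<tau> M x < V \<tau> M y"
    by (rule DERIV_pos_imp_increasing) (use V_deriv in blast)
qed

text \<open>\<open>V\<close> is 0 at 0 and \<open>(M + 2) * pi\<close> at \<open>pi\<close>, and
  \<open>(m + 1) * pi\<close> lies strictly between. The intermediate value theorem gives a
  solution; strict monotonicity makes it unique on the whole line, as \<open>THE\<close>
  demands.\<close>

lemma spectral_value_props:
  defines "\<xi> \<equiv> spectral_value \<tau> M m"
  shows "V \<tau> M \<xi> = (of_int m + 1) * pi" "0 < \<xi>" "\<xi> < pi"
proof -
  have V0: "V \<tau> M 0 = 0" and Vpi: "V \<tau> M pi = (of_int M + 2) * pi"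
    by (simp_all add: V_eq \<theta>_arctan_def algebra_simps)
  have m': "0 < (of_int m + 1) * pi" "(of_int m + 1) * pi < (of_int M + 2) * pi"
    using m by (auto simp: \<Lambda>_def intro!: mult_strict_right_mono)
  have "isCont (V \<tau> M) x" for x
    using V_deriv[of x] DERIV_isCont by blast
  then obtain x where x: "V \<tau> M x = (of_int m + 1) * pi"
    using IVT[of "V \<tau> M" 0 "(of_int m + 1) * pi" pi] m' V0 Vpi by fastforce
  then have "y = x" if "V \<tau> M y = (of_int m + 1) * pi" for y
    using that strict_mono_eq[OF V_strict_mono] by metis
  with x have "\<xi> = x"
    unfolding \<xi>_def spectral_value_def by (intro the_equality)
  with x show V: "V \<tau> M \<xi> = (of_int m + 1) * pi"
    by simp
  show "0 < \<xi>" "\<xi> < pi"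
    using m' V V0 Vpi strict_mono_less[OF V_strict_mono] by metis+
qed

text \<open>This is the exponential of \<open>V \<xi> = (m + 1) * pi\<close>. The additional
  \<open>pi\<close> gives a factor -1 that turns \<open>1 - \<tau>^2 * z^2\<close> into
  \<open>\<tau>^2 * z^2 - 1\<close>.\<close>

lemma bethe_equation:
  fixes z :: complex
  defines "z \<equiv> cis (spectral_value \<tau> M m)"
  shows "z powi M * (z\<^sup>2 - of_real (\<tau>\<^sup>2)) = (-1) powi m * (of_real (\<tau>\<^sup>2) * z\<^sup>2 - 1)"
proof -
  define \<xi> where "\<xi> = spectral_value \<tau> M m"
  have z2: "z\<^sup>2 = cis (2 * \<xi>)"
    by (simp add: z_def \<xi>_def power2_eq_square cis_mult)
  have zM: "z powi M = cis (of_int M * \<xi>)"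
    by (simp add: z_def \<xi>_def cis_conv_exp exp_power_int mult_ac)
  have "z powi M * (z\<^sup>2 - of_real (\<tau>\<^sup>2)) =
    cis (of_int M * \<xi>) * cis (\<theta>_arctan (\<tau>\<^sup>2) (2 * \<xi>)) * (1 - of_real (\<tau>\<^sup>2) * z\<^sup>2)"
    unfolding zM z2 using cis_\<theta>_arctan[OF \<tau>2, of "2 * \<xi>"] by simp
  also have "cis (of_int M * \<xi>) * cis (\<theta>_arctan (\<tau>\<^sup>2) (2 * \<xi>)) = cis (of_int m * pi) * cis pi"
    unfolding cis_mult \<xi>_def using spectral_value_props(1)
    by (simp only: V_eq distrib_right mult_1)
  also have "cis (of_int m * pi) = cis pi powi m"
    unfolding cis_conv_exp exp_power_int by (simp add: mult_ac)
  finally show ?thesis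
    by (simp add: algebra_simps)
qed

end

theorem theorem7p1:
  fixes \<tau> :: real and M m :: int
  assumes "0 < \<tau>" "\<tau> < 1" and "M > 1" and "m \<in> \<Lambda> M"
  shows "let \<xi> = spectral_value \<tau> M m; \<Phi> = spherical \<tau> M \<xi> in
    W_S_invariant M \<Phi> \<and>
    (\<forall>n\<in>\<Lambda> M. \<Phi> n \<in> \<real>) \<and>
    laplacian \<tau> M \<Phi> = (\<lambda>n. of_real (2 * cos \<xi>) * \<Phi> n) \<and>
    is_eigenfunction \<tau> M (restrict \<Phi> (\<Lambda> M)) (of_real (2 * cos \<xi>))"
proof -
  define \<xi> where "\<xi> = spectral_value \<tau> M m"
  define z where "z = cis \<xi>"
  define f where "f = \<phi> \<tau> M \<xi>"
  define \<epsilon> :: complex where "\<epsilon> = (-1) powi m"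
  define \<Phi> where "\<Phi> = spherical \<tau> M \<xi>"
  have M: "M > 0" and \<tau>: "\<tau> \<noteq> 0"
    using assms by auto
  \<comment> \<open>Since \<xi> lies strictly between 0 and \<open>pi\<close>, \<open>z\<close> is
    not real.\<close>
  have "sin \<xi> > 0"
    using spectral_value_props[OF assms] by (simp add: \<xi>_def sin_gt_zero)
  then have "z \<noteq> 1" "z \<noteq> -1"
    by (auto simp: z_def complex_eq_iff)
  then have z2: "z\<^sup>2 \<noteq> 1"
    using power2_eq_1_iff by blast
  interpret wave: wave_pair \<tau> \<xi> M z "(z\<^sup>2 - of_real (\<tau>\<^sup>2)) / (z\<^sup>2 - 1)"
    "(of_real (\<tau>\<^sup>2) * z\<^sup>2 - 1) / (z\<^sup>2 - 1)"
    using \<tau> z2 by unfold_locales (simp_all add: z_def)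
  have \<epsilon>: "\<epsilon> * \<epsilon> = 1"
    by (simp add: \<epsilon>_def flip: power_int_mult_distrib)
  have reflect: "f (M - n) = \<epsilon> * f n" for n
    unfolding f_def using bethe_equation[OF assms] wave.\<phi>_reflect[OF _ \<epsilon>]
    by (simp add: \<xi>_def \<epsilon>_def z_def)
  have I: "I_op \<tau> M f = (\<lambda>n. of_real \<tau> * f n)"
    unfolding f_def using wave.I_op_\<phi> .
  have \<Phi>: "\<Phi> = (\<lambda>n. f (fold_\<Lambda> M n))"
    unfolding \<Phi>_def spherical_def f_def[symmetric]
    using \<J>_joint_eigenfunction[OF M \<tau> I_refl_eigenfunction[OF I reflect \<epsilon>] I_refl_scale] by auto
  have invariant: "W_S_invariant M \<Phi>"
    unfolding W_S_invariant_def
  proof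
    fix w
    assume "w \<in> W_S"
    then have "inv\<^bsub>W\<^esub> w \<in> W_S"
      by (rule subgroup.m_inv_closed[OF subgroup_W_S])
    then show "fun_act M w \<Phi> = \<Phi>"
      by (simp add: fun_act_def \<Phi> fold_\<Lambda>_W_S[OF M])
  qed
  have real: "\<Phi> n \<in> \<real>" for n
    unfolding \<Phi> f_def using wave.\<phi>_real .
  \<comment> \<open>At \<open>n = 1\<close> the sum in \<open>J_op\<close> is the single term
    \<open>f (-1)\<close>, so the eigenvalue equation of \<open>I\<close> becomes the boundary
    condition at 0.\<close>
  have "of_real \<tau> * f 1 = of_real \<tau> * f (-1) - of_real (\<tau> - inverse \<tau>) * f (-1)"
    using fun_cong[OF I, of 1] by (simp add: I_op_def fun_act_w_s J_op_def)
  then have left: "f (-1) = of_real (\<tau>\<^sup>2) * f 1"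
    using \<tau> by (simp add: field_simps power2_eq_square)
  have right: "f (M + 1) = of_real (\<tau>\<^sup>2) * f (M - 1)"
    using reflect[of "-1"] reflect[of 1] left by simp
  have eigen: "laplacian \<tau> M \<Phi> = (\<lambda>n. of_real (2 * cos \<xi>) * \<Phi> n)"
    unfolding \<Phi>
    using laplacian_invariant_extension[OF assms(3) _ left right]
      wave.\<phi>_recurrence unfolding f_def by blast
  have "\<Phi> (-1) = \<Phi> 1" "\<Phi> (M + 1) = \<Phi> (M - 1)"
    using fold_\<Lambda>_uminus[OF M, of 1] fold_\<Lambda>_reflect[OF M, of "M - 1"] by (simp_all add: \<Phi> add.commute)
  from laplacian_\<Lambda>_restrict[of M \<Phi> \<tau>, OF assms(3) this]
  have "laplacian_\<Lambda> \<tau> M (restrict \<Phi> (\<Lambda> M)) = (\<lambda>n\<in>\<Lambda> M. of_real (2 * cos \<xi>) * restrict \<Phi> (\<Lambda> M) n)"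
    unfolding eigen by (auto simp: fun_eq_iff)
  moreover have "restrict \<Phi> (\<Lambda> M) \<in> l2 \<tau> M"
    by (simp add: l2_def \<Lambda>_def summable_on_finite)
  \<comment> \<open>The witness is 0: \<open>J_op\<close> vanishes there, which leaves the value
    \<open>1 + \<tau>^2\<close>.\<close>
  moreover have "\<exists>n\<in>\<Lambda> M. restrict \<Phi> (\<Lambda> M) n \<noteq> 0"
  proof
    show 0: "0 \<in> \<Lambda> M"
      using M by (simp add: \<Lambda>_def)
    have "1 + \<tau>\<^sup>2 \<noteq> 0"
      by (smt (verit) zero_le_power2)
    then have "1 + complex_of_real (\<tau>\<^sup>2) \<noteq> 0"
      by (metis of_real_1 of_real_add of_real_eq_0_iff)
    then show "restrict \<Phi> (\<Lambda> M) 0 \<noteq> 0"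
      using 0 by (simp add: \<Phi> fold_\<Lambda>_id[OF M] f_def \<phi>_0)
  qed
  ultimately have "is_eigenfunction \<tau> M (restrict \<Phi> (\<Lambda> M)) (of_real (2 * cos \<xi>))"
    by (simp add: is_eigenfunction_def)
  with invariant real eigen show ?thesis
    by (simp add: Let_def flip: \<xi>_def \<Phi>_def)
qed

end
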